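(* Let $A\in\mathbb{R}^{n\times n}$, $C\in\mathbb{R}^{p\times n}$, let $T\ge1$ and $q\ge0$ be integers, and assume that $q$ errors are correctable after $T$ steps for $(A,C)$, i.e. that $$|\mathrm{supp}(Cz)\cup\mathrm{supp}(CAz)\cup\dots\cup\mathrm{supp}(CA^{T-1}z)|>2q\quad\text{for all } z\in\mathbb{R}^n\setminus\{0\}.$$ Then the decoder $D_0^T$ corrects $q$ errors: for any $x^{(0)}\in\mathbb{R}^n$ and any $e^{(0)},\dots,e^{(T-1)}$ in $\mathbb{R}^p$ such that $\mathrm{supp}(e^{(t)})\subset K$ for all $t$, for some $K\subset\{1,\dots,p\}$ with $|K|\le q$, we have $D_0^T(y^{(0)},\dots,y^{(T-1)})=x^{(0)}$, where $y^{(t)}=CA^tx^{(0)}+e^{(t)}$ for $t=0,\dots,T-1$.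
   Context: For $x\in\mathbb{R}^p$, $\mathrm{supp}(x)=\{i : x_i\neq 0\}$. The decoder $D_0^T:(\mathbb{R}^p)^T\to\mathbb{R}^n$ is defined by letting $D_0^T(y^{(0)},\dots,y^{(T-1)})$ be the optimal $\hat x$ of the optimization problem $$\text{minimize } |\hat K| \text{ over } \hat x\in\mathbb{R}^n,\ \hat K\subset\{1,\dots,p\},\quad\text{subject to } \mathrm{supp}(y^{(t)}-CA^t\hat x)\subset\hat K \text{ for } t\in\{0,\dots,T-1\}.$$ The equality $D_0^T(y^{(0)},\dots,y^{(T-1)})=x^{(0)}$ means that $x^{(0)}$ is the unique optimal $\hat x$. *)

theory Defs
  imports "HOL-Analysis.Analysis"
begin

definition supp :: "real ^ 'p \<Rightarrow> 'p set" where
  "supp x = {i. x $ i \<noteq> 0}"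

text \<open>Powers of a square matrix with respect to the matrix product \<open>**\<close>; the overloaded
  operations \<open>*\<close> and \<open>^\<close> on vectors and matrices act componentwise.\<close>

primrec matpow :: "real ^ 'n ^ 'n \<Rightarrow> nat \<Rightarrow> real ^ 'n ^ 'n" where
  "matpow A 0 = mat 1"
| "matpow A (Suc t) = A ** matpow A t"

text \<open>A measurement sequence in \<open>(\<real>\<^sup>p)\<^sup>T\<close> is represented by a function on \<open>nat\<close>
  of which only the values at \<open>t < T\<close> are used.\<close>

definition D0_feasible ::
  "real ^ 'n ^ 'n \<Rightarrow> real ^ 'n ^ 'p \<Rightarrow> nat \<Rightarrow> (nat \<Rightarrow> real ^ 'p) \<Rightarrow> real ^ 'n \<Rightarrow> 'p set \<Rightarrow> bool" where
  "D0_feasible A C T y x K \<longleftrightarrow> (\<forall>t<T. supp (y t - (C ** matpow A t) *v x) \<subseteq> K)"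

definition D0_optimal ::
  "real ^ 'n ^ 'n \<Rightarrow> real ^ 'n ^ 'p \<Rightarrow> nat \<Rightarrow> (nat \<Rightarrow> real ^ 'p) \<Rightarrow> real ^ 'n \<Rightarrow> bool" where
  "D0_optimal A C T y x \<longleftrightarrow>
    (\<exists>K. D0_feasible A C T y x K \<and>
      (\<forall>x' K'. D0_feasible A C T y x' K' \<longrightarrow> card K \<le> card K'))"

text \<open>The decoder is a partial function, undefined when the optimal state is not unique, so that
  \<open>D0 A C T y = Some x\<close> says that \<open>x\<close> is the unique optimal state.\<close>

definition D0 ::
  "real ^ 'n ^ 'n \<Rightarrow> real ^ 'n ^ 'p \<Rightarrow> nat \<Rightarrow> (nat \<Rightarrow> real ^ 'p) \<Rightarrow> (real ^ 'n) option" where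
  "D0 A C T y =
    (if \<exists>!x. D0_optimal A C T y x then Some (THE x. D0_optimal A C T y x) else None)"

end

theory Submission
  imports Defs
begin

text \<open>If a state \<open>x \<noteq> x0\<close> explains the measurements with attacked set \<open>K'\<close>, then \<open>C A\<^sup>t (x0 - x)\<close> is
  for every \<open>t < T\<close> a difference of two residuals, hence supported in \<open>K \<union> K'\<close>. Since
  \<open>|K \<union> K'| > 2 q\<close> and \<open>|K| \<le> q\<close>, we get \<open>|K'| > q\<close>, so \<open>x\<close> cannot compete with \<open>x0\<close>.\<close>

lemma supp_diff_subset: "supp (u - v) \<subseteq> supp u \<union> supp v"
  by (auto simp: supp_def)

text \<open>The measurement \<open>y t\<close> cancels when the residuals of the two states are
  subtracted, so only their supports remain.\<close>

lemma supp_difference_of_feasible_states: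
  assumes "D0_feasible A C T y x K" "D0_feasible A C T y x' K'"
  shows "(\<Union>t<T. supp ((C ** matpow A t) *v (x - x'))) \<subseteq> K \<union> K'"
proof (rule UN_least)
  fix t assume "t \<in> {..<T}"
  let ?M = "C ** matpow A t"
  have "?M *v (x - x') = (y t - ?M *v x') - (y t - ?M *v x)"
    by (simp add: matrix_vector_mult_diff_distrib)
  then have "supp (?M *v (x - x')) \<subseteq> supp (y t - ?M *v x') \<union> supp (y t - ?M *v x)"
    by (metis supp_diff_subset)
  also have "\<dots> \<subseteq> K \<union> K'"
    using assms \<open>t \<in> {..<T}\<close> by (fastforce simp: D0_feasible_def)
  finally show "supp (?M *v (x - x')) \<subseteq> K \<union> K'" .
qed

lemma card_feasible_gt:
  assumes "\<forall>z. z \<noteq> 0 \<longrightarrow> card (\<Union>t<T. supp ((C ** matpow A t) *v z)) > 2 * q"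
    and "D0_feasible A C T y x K" "card K \<le> q"
    and "D0_feasible A C T y x' K'" "x' \<noteq> x"
  shows "q < card K'"
proof -
  have "2 * q < card (\<Union>t<T. supp ((C ** matpow A t) *v (x - x')))"
    using assms(1,5) by simp
  also have "\<dots> \<le> card (K \<union> K')"
    using supp_difference_of_feasible_states[OF assms(2,4)] by (intro card_mono) simp_all
  also have "\<dots> \<le> card K + card K'"
    by (rule card_Un_le)
  finally show ?thesis
    using assms(3) by linarith
qed

theorem proposition5:
  fixes A :: "real ^ 'n ^ 'n" and C :: "real ^ 'n ^ 'p" and T q :: nat
  assumes "T \<ge> 1"
    and "\<forall>z. z \<noteq> 0 \<longrightarrow> card (\<Union>t<T. supp ((C ** matpow A t) *v z)) > 2 * q"
  shows "\<forall>(x0 :: real ^ 'n) (e :: nat \<Rightarrow> real ^ 'p) (y :: nat \<Rightarrow> real ^ 'p).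
    (\<exists>K. card K \<le> q \<and> (\<forall>t<T. supp (e t) \<subseteq> K)) \<longrightarrow>
    (\<forall>t<T. y t = (C ** matpow A t) *v x0 + e t) \<longrightarrow>
    D0 A C T y = Some x0"
proof (intro allI impI)
  fix x0 :: "real ^ 'n" and e y :: "nat \<Rightarrow> real ^ 'p"
  assume "\<exists>K. card K \<le> q \<and> (\<forall>t<T. supp (e t) \<subseteq> K)"
    and y: "\<forall>t<T. y t = (C ** matpow A t) *v x0 + e t"
  then obtain K where K: "card K \<le> q" "\<forall>t<T. supp (e t) \<subseteq> K"
    by blast
  \<comment> \<open>The given \<open>K\<close> may be larger than necessary. The residual of
    \<open>x0\<close> at time \<open>t\<close> is exactly \<open>e t\<close>, so \<open>K0\<close>
    is the least set feasible for \<open>x0\<close>.\<close>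
  define K0 where "K0 = (\<Union>t<T. supp (e t))"
  have feasible_iff: "D0_feasible A C T y x0 K' \<longleftrightarrow> K0 \<subseteq> K'" for K'
    using y by (auto simp: D0_feasible_def K0_def)
  have "card K0 \<le> card K"
    by (rule card_mono) (use K in \<open>auto simp: K0_def\<close>)
  then have card_K0: "card K0 \<le> q"
    using K by simp
  \<comment> \<open>This strict bound serves twice: for the optimality of \<open>x0\<close> and for
    its uniqueness.\<close>
  have other: "q < card K'" if "D0_feasible A C T y x K'" "x \<noteq> x0" for x K'
    using card_feasible_gt[OF assms(2) _ card_K0 that] feasible_iff by blast
  have "card K0 \<le> card K'" if "D0_feasible A C T y x K'" for x K'
  proof (cases "x = x0")
    case True
    then show ?thesis
      using that feasible_iff by (simp add: card_mono)
  next
    case False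
    then show ?thesis
      using other that card_K0 by fastforce
  qed
  then have opt: "D0_optimal A C T y x0"
    unfolding D0_optimal_def using feasible_iff by blast
  have "x = x0" if "D0_optimal A C T y x" for x
  proof (rule ccontr)
    assume "x \<noteq> x0"
    \<comment> \<open>The set witnessing optimality of \<open>x\<close> is compared with the
      feasible pair \<open>x0\<close>, \<open>K0\<close>, which forces its size down to at most
      \<open>q\<close>.\<close>
    obtain K' where "D0_feasible A C T y x K'" "card K' \<le> card K0"
      using \<open>D0_optimal A C T y x\<close> feasible_iff unfolding D0_optimal_def by blast
    then show False
      using other \<open>x \<noteq> x0\<close> card_K0 by fastforce
  qed
  then show "D0 A C T y = Some x0"
    using opt unfolding D0_def by (metis the_equality)
qed

end
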